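(* Let $q\geq 2$ and let $\gamma$ be an integer. A completely regular code $C$ in $H(3,q)$ with covering radius $1$, parameter $\gamma$ and $\gamma\leq\beta$ exists if and only if one of the following holds: (1) $C$ has eigenvalue $\lambda_1(3,q)$ and $0<\gamma\leq q/2$; (2) $C$ has eigenvalue $\lambda_2(3,q)$ and one of: ($\gamma$ even and $2\leq\gamma\leq q$); ($q$ even and $\frac q2\leq\gamma\leq q$); ($q$ even, $\gamma$ odd, $\gamma<\frac q2$ and Condition 1 holds for $q$ and $\gamma$); (3) $C$ has eigenvalue $\lambda_3(3,q)$ and $\gamma$ is a nonzero integer divisible by $3$. (Each case is to be read as: for the given eigenvalue, a code with that eigenvalue and parameter $\gamma$ exists iff the stated condition on $q,\gamma$ holds.)
   Context: Let $\mathcal{A}$ be a set of size $q\geq 2$. The Hamming graph $H(3,q)$ has vertex set $\mathcal{A}^3$, two tuples being adjacent iff they differ in exactly one position; it is $3(q-1)$-regular and its eigenvalues are $\lambda_i(3,q)=3(q-1)-qi$, $i=0,\dots,3$. A set $C$ of vertices is a completely regular code with covering radius $1$ if $C$ is a nonempty proper subset and there are integers $\beta$ and $\gamma\geq 1$ such that every vertex of $C$ has exactly $\beta$ neighbours outside $C$ and every vertex outside $C$ has exactly $\gamma$ neighbours in $C$. Its eigenvalues are $3(q-1)$ and $3(q-1)-(\beta+\gamma)$; "the code has eigenvalue $\lambda_i(3,q)$" ($i\geq1$) means $\beta+\gamma=qi$. Condition 1 (for $q$ and $\gamma$): there exist integers $r,s,t$ with $0<r,s,t<q$ and integers $a,b,c$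 with $0<c\leq\min\{q-s,q-t\}$, $0<b\leq \min\{t,q-r\}$, $0<a\leq\min\{r,s\}$ such that $cr=a(q-t)$, $b(q-s)=c(q-r)$, $at=bs$, and $\gamma=a+b+c$.
   Formalization: The condition γ≤β is taken as a hypothesis on the parameters, and in (3) "nonzero" is read as "positive": literally, (3) would also claim a code with γ≤β for γ=−3, or for q=2 and γ=6, where none exists. *)

theory Defs
  imports Main
begin

section \<open>The Hamming graph \<open>H(3,q)\<close>\<close>

definition hamming_vertices :: "'a set \<Rightarrow> ('a \<times> 'a \<times> 'a) set" where
  "hamming_vertices A = A \<times> A \<times> A"

definition hamming_distance :: "'a \<times> 'a \<times> 'a \<Rightarrow> 'a \<times> 'a \<times> 'a \<Rightarrow> nat" where
  "hamming_distance u v = (case (u, v) of ((x1, x2, x3), (y1, y2, y3)) \<Rightarrow>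
     of_bool (x1 \<noteq> y1) + of_bool (x2 \<noteq> y2) + of_bool (x3 \<noteq> y3))"

definition hamming_adjacent :: "'a \<times> 'a \<times> 'a \<Rightarrow> 'a \<times> 'a \<times> 'a \<Rightarrow> bool" where
  "hamming_adjacent u v \<longleftrightarrow> hamming_distance u v = 1"

definition hamming_eigenvalue :: "nat \<Rightarrow> nat \<Rightarrow> int" where
  "hamming_eigenvalue q i = 3 * (int q - 1) - int q * int i"

section \<open>Completely regular codes with covering radius 1\<close>

definition completely_regular_code ::
    "'a set \<Rightarrow> ('a \<times> 'a \<times> 'a) set \<Rightarrow> int \<Rightarrow> int \<Rightarrow> bool" where
  "completely_regular_code A C \<beta> \<gamma> \<longleftrightarrow>
     C \<noteq> {} \<and> C \<subset> hamming_vertices A \<and> \<gamma> \<ge> 1 \<and>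
     (\<forall>v\<in>C. int (card {w \<in> hamming_vertices A - C. hamming_adjacent v w}) = \<beta>) \<and>
     (\<forall>v\<in>hamming_vertices A - C. int (card {w \<in> C. hamming_adjacent v w}) = \<gamma>)"

text \<open>The quotient matrix of a code with parameters \<open>\<beta>\<close>, \<open>\<gamma>\<close> has rows
  \<open>(3(q-1) - \<beta>, \<beta>)\<close> and \<open>(\<gamma>, 3(q-1) - \<gamma>)\<close>. Its eigenvalues are the valency
  \<open>3(q-1)\<close> and the following one, which is what is called the eigenvalue of the code.\<close>

definition code_eigenvalue :: "nat \<Rightarrow> int \<Rightarrow> int \<Rightarrow> int" where
  "code_eigenvalue q \<beta> \<gamma> = 3 * (int q - 1) - (\<beta> + \<gamma>)"

lemma code_eigenvalue_eq_iff:
  "code_eigenvalue q \<beta> \<gamma> = hamming_eigenvalue q i \<longleftrightarrow> \<beta> + \<gamma> = int q * int i"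
  by (auto simp: code_eigenvalue_def hamming_eigenvalue_def)

definition condition1 :: "nat \<Rightarrow> int \<Rightarrow> bool" where
  "condition1 q \<gamma> \<longleftrightarrow>
     (\<exists>r s t a b c :: int.
        0 < r \<and> r < int q \<and> 0 < s \<and> s < int q \<and> 0 < t \<and> t < int q \<and>
        0 < c \<and> c \<le> min (int q - s) (int q - t) \<and>
        0 < b \<and> b \<le> min t (int q - r) \<and>
        0 < a \<and> a \<le> min r s \<and>
        c * r = a * (int q - t) \<and>
        b * (int q - s) = c * (int q - r) \<and>
        a * t = b * s \<and>
        \<gamma> = a + b + c)"

end

(* Let theta = 3q - beta - gamma. A nonempty proper subset C is a completely regular code iff the
   numbers of points of C on the three lines through a vertex sum up to gamma + theta on C and to
   gamma off C. Summing this equation over planes and then over lines forces theta = 2q, q or 0,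
   with parity and divisibility conditions on gamma in the last two cases.

   If theta = q and 2 gamma < q, each point of C lies on a line contained in C, so C is a disjoint
   union of full lines. If a single direction does not occur, gamma is even; if all three occur,
   the incidences between the constant coordinates of the lines are biregular bipartite graphs,
   whose degrees and part sizes are exactly the data of Condition 1. Conversely, biregular
   bipartite graphs of all admissible parameters exist, which gives the codes. For q even, gamma
   odd and q <= 2 gamma, one adds two boxes to a union of parallel lines. *)

theory Submission
  imports Defs
begin

section \<open>Line sums\<close>

text \<open>The neighbours of a vertex are the other points of the three lines through it. If the
  vertex lies in \<open>D\<close>, each of the three line counts includes it, whence the correction
  by 3.\<close>

lemma card_neighbours:
  assumes "finite A" "D \<subseteq> hamming_vertices A" "x \<in> A" "y \<in> A" "z \<in> A"
  shows "int (card {w \<in> D. hamming_adjacent (x, y, z) w}) =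
    int (card {u \<in> A. (u, y, z) \<in> D}) + int (card {u \<in> A. (x, u, z) \<in> D})
    + int (card {u \<in> A. (x, y, u) \<in> D}) - 3 * of_bool ((x, y, z) \<in> D)"
proof -
  define X where "X = {u \<in> A - {x}. (u, y, z) \<in> D}"
  define Y where "Y = {u \<in> A - {y}. (x, u, z) \<in> D}"
  define Z where "Z = {u \<in> A - {z}. (x, y, u) \<in> D}"
  have fin: "finite X" "finite Y" "finite Z"
    using assms(1) by (auto simp: X_def Y_def Z_def)
  have eq: "{w \<in> D. hamming_adjacent (x, y, z) w} =
      (\<lambda>u. (u, y, z)) ` X \<union> (\<lambda>u. (x, u, z)) ` Y \<union> (\<lambda>u. (x, y, u)) ` Z"
  proof (rule set_eqI)
    fix w :: "'a \<times> 'a \<times> 'a"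
    obtain u v t where w: "w = (u, v, t)" by (cases w) auto
    have A: "w \<in> D \<Longrightarrow> u \<in> A \<and> v \<in> A \<and> t \<in> A"
      using assms(2) by (auto simp: w hamming_vertices_def)
    have adj: "hamming_adjacent (x, y, z) w \<longleftrightarrow> u \<noteq> x \<and> v = y \<and> t = z
        \<or> u = x \<and> v \<noteq> y \<and> t = z \<or> u = x \<and> v = y \<and> t \<noteq> z"
      by (auto simp: w hamming_adjacent_def hamming_distance_def)
    show "w \<in> {w \<in> D. hamming_adjacent (x, y, z) w} \<longleftrightarrow>
        w \<in> (\<lambda>u. (u, y, z)) ` X \<union> (\<lambda>u. (x, u, z)) ` Y \<union> (\<lambda>u. (x, y, u)) ` Z"
      using A unfolding mem_Collect_eq adj by (auto simp: w X_def Y_def Z_def)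
  qed
  let ?X = "(\<lambda>u. (u, y, z)) ` X" and ?Y = "(\<lambda>u. (x, u, z)) ` Y" and ?Z = "(\<lambda>u. (x, y, u)) ` Z"
  have "card (?X \<union> ?Y \<union> ?Z) = card (?X \<union> ?Y) + card ?Z"
    using fin by (intro card_Un_disjoint) (auto simp: X_def Y_def Z_def)
  also have "card (?X \<union> ?Y) = card ?X + card ?Y"
    using fin by (intro card_Un_disjoint) (auto simp: X_def Y_def)
  also have "card ?X = card X" by (intro card_image inj_onI) simp
  also have "card ?Y = card Y" by (intro card_image inj_onI) simp
  also have "card ?Z = card Z" by (intro card_image inj_onI) simp
  finally have sum: "card {w \<in> D. hamming_adjacent (x, y, z) w} = card X + card Y + card Z"
    unfolding eq .
  have *: "int (card {u \<in> A - {p}. Q u}) = int (card {u \<in> A. Q u}) - of_bool (Q p)"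
    if "p \<in> A" for p Q
  proof (cases "Q p")
    case True
    then have "{u \<in> A. Q u} = insert p {u \<in> A - {p}. Q u}" using that by auto
    then have "card {u \<in> A. Q u} = Suc (card {u \<in> A - {p}. Q u})"
      using assms(1) by simp
    then show ?thesis using True by simp
  next
    case False
    then have "{u \<in> A - {p}. Q u} = {u \<in> A. Q u}" by auto
    then show ?thesis using False by simp
  qed
  show ?thesis
    unfolding sum X_def Y_def Z_def
    by (simp only: of_nat_add *[OF assms(3)] *[OF assms(4)] *[OF assms(5)])
qed

text \<open>Off \<open>C\<close> the points of \<open>C\<close> on the three lines through a vertex
  are exactly its neighbours in \<open>C\<close>. On \<open>C\<close> the line counts of the
  complement add up to \<beta>, because the vertex itself is not in the complement.\<close>

lemma completely_regular_code_iff_line_sums: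
  assumes "finite A"
  shows "completely_regular_code A C \<beta> \<gamma> \<longleftrightarrow>
    C \<noteq> {} \<and> C \<subset> hamming_vertices A \<and> \<gamma> \<ge> 1 \<and>
    (\<forall>x\<in>A. \<forall>y\<in>A. \<forall>z\<in>A.
      int (card {u \<in> A. (u, y, z) \<in> C}) + int (card {u \<in> A. (x, u, z) \<in> C})
        + int (card {u \<in> A. (x, y, u) \<in> C})
      = (if (x, y, z) \<in> C then 3 * int (card A) - \<beta> else \<gamma>))"
    (is "_ \<longleftrightarrow> _ \<and> _ \<and> _ \<and> (\<forall>x\<in>A. \<forall>y\<in>A. \<forall>z\<in>A. ?s x y z = _)")
proof (cases "C \<subset> hamming_vertices A")
  case True
  then have sub: "C \<subseteq> hamming_vertices A" by auto
  let ?V = "hamming_vertices A"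
  have comp: "int (card {u \<in> A. g u \<in> ?V - C}) = int (card A) - int (card {u \<in> A. g u \<in> C})"
    if "\<And>u. u \<in> A \<Longrightarrow> g u \<in> ?V" for g
  proof -
    have "{u \<in> A. g u \<in> ?V - C} = A - {u \<in> A. g u \<in> C}" using that by auto
    moreover have "card {u \<in> A. g u \<in> C} \<le> card A"
      using assms by (auto intro: card_mono)
    ultimately show ?thesis
      using assms by (simp add: card_Diff_subset of_nat_diff)
  qed
  have inner: "int (card {w \<in> C. hamming_adjacent (x, y, z) w}) = ?s x y z"
    if "(x, y, z) \<in> ?V - C" for x y z
    using that card_neighbours[OF assms sub, of x y z] by (auto simp: hamming_vertices_def)
  have outer: "int (card {w \<in> ?V - C. hamming_adjacent (x, y, z) w})
      = 3 * int (card A) - ?s x y z" if "(x, y, z) \<in> C" for x y z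
  proof -
    have V: "x \<in> A" "y \<in> A" "z \<in> A" using that sub by (auto simp: hamming_vertices_def)
    have m: "(u, y, z) \<in> ?V" "(x, u, z) \<in> ?V" "(x, y, u) \<in> ?V" if "u \<in> A" for u
      using V that by (auto simp: hamming_vertices_def)
    show ?thesis
      using card_neighbours[OF assms _ V, of "?V - C"] that m
      by (simp only: comp) auto
  qed
  have 1: "(\<forall>v\<in>C. int (card {w \<in> ?V - C. hamming_adjacent v w}) = \<beta>) \<longleftrightarrow>
      (\<forall>x\<in>A. \<forall>y\<in>A. \<forall>z\<in>A. (x, y, z) \<in> C \<longrightarrow> ?s x y z = 3 * int (card A) - \<beta>)"
    using sub outer by (fastforce simp: hamming_vertices_def)
  have 2: "(\<forall>v\<in>?V - C. int (card {w \<in> C. hamming_adjacent v w}) = \<gamma>) \<longleftrightarrow>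
      (\<forall>x\<in>A. \<forall>y\<in>A. \<forall>z\<in>A. (x, y, z) \<notin> C \<longrightarrow> ?s x y z = \<gamma>)"
    using inner by (fastforce simp: hamming_vertices_def)
  show ?thesis
    unfolding completely_regular_code_def 1 2 by (simp split: if_split) blast
next
  case False
  then show ?thesis by (simp add: completely_regular_code_def)
qed

text \<open>The right line sums already make the code nonempty and proper: for the empty set they
  would be 0, against \<gamma> \<ge> 1, and for the whole space \<open>3 * card A\<close>, against
  \<beta> \<ge> 1.\<close>

lemma completely_regular_codeI:
  assumes "finite A" "A \<noteq> {}" "\<gamma> \<ge> 1" "\<beta> \<ge> 1"
    and sums: "\<And>x y z. x \<in> A \<Longrightarrow> y \<in> A \<Longrightarrow> z \<in> A \<Longrightarrow>
      int (card {u \<in> A. P u y z}) + int (card {u \<in> A. P x u z}) + int (card {u \<in> A. P x y u})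
      = (if P x y z then 3 * int (card A) - \<beta> else \<gamma>)"
  shows "\<exists>C. completely_regular_code A C \<beta> \<gamma>"
proof -
  define C where "C = {(x, y, z) \<in> hamming_vertices A. P x y z}"
  have C: "(x, y, z) \<in> C \<longleftrightarrow> P x y z" if "x \<in> A" "y \<in> A" "z \<in> A" for x y z
    using that by (simp add: C_def hamming_vertices_def)
  have eq: "{u \<in> A. (u, y, z) \<in> C} = {u \<in> A. P u y z}"
    "{u \<in> A. (x, u, z) \<in> C} = {u \<in> A. P x u z}"
    "{u \<in> A. (x, y, u) \<in> C} = {u \<in> A. P x y u}"
    if "x \<in> A" "y \<in> A" "z \<in> A" for x y z
    using that by (auto simp: C)
  obtain p where p: "p \<in> A" using assms(2) by blast
  have "C \<noteq> {}"
  proof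
    assume "C = {}"
    then have "\<not> P x y z" if "x \<in> A" "y \<in> A" "z \<in> A" for x y z using C that by blast
    then have "card {u \<in> A. P u p p} = 0" "card {u \<in> A. P p u p} = 0"
      "card {u \<in> A. P p p u} = 0" "\<not> P p p p"
      using p by (auto simp: card_eq_0_iff)
    then show False using sums[OF p p p] assms(3) by simp
  qed
  moreover have "C \<noteq> hamming_vertices A"
  proof
    assume "C = hamming_vertices A"
    then have P: "P x y z" if "x \<in> A" "y \<in> A" "z \<in> A" for x y z
      using C that by (auto simp: hamming_vertices_def)
    then have "{u \<in> A. P u p p} = A" "{u \<in> A. P p u p} = A" "{u \<in> A. P p p u} = A"
      using p by auto
    then show False using sums[OF p p p] P[OF p p p] assms(4) by simp
  qed
  moreover have "C \<subseteq> hamming_vertices A" by (auto simp: C_def)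
  ultimately have "completely_regular_code A C \<beta> \<gamma>"
    unfolding completely_regular_code_iff_line_sums[OF assms(1)]
    using assms(3) by (auto simp: eq C sums)
  then show ?thesis ..
qed

section \<open>The eigenvalue is one of the Hamming graph\<close>

context
  fixes A :: "'a set" and q :: int and \<gamma> \<theta> :: int
  assumes fin: "finite A" and q: "q = int (card A)"
begin

text \<open>The equation is summed over the plane with first coordinate \<open>x\<close>. The lines
  in the first direction cross this plane once each and add up to the total of \<open>f\<close>;
  each of the other two directions stays inside the plane and counts it \<open>q\<close>
  times.\<close>

lemma plane_sum_equation:
  fixes f :: "'a \<Rightarrow> 'a \<Rightarrow> 'a \<Rightarrow> int"
  assumes f: "\<And>x y z. x \<in> A \<Longrightarrow> y \<in> A \<Longrightarrow> z \<in> A \<Longrightarrow>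
      (\<Sum>u\<in>A. f u y z) + (\<Sum>u\<in>A. f x u z) + (\<Sum>u\<in>A. f x y u) = \<gamma> + \<theta> * f x y z"
    and "x \<in> A"
  shows "(2 * q - \<theta>) * (\<Sum>y\<in>A. \<Sum>z\<in>A. f x y z)
    = \<gamma> * q^2 - (\<Sum>x\<in>A. \<Sum>y\<in>A. \<Sum>z\<in>A. f x y z)"
proof -
  let ?P = "\<Sum>y\<in>A. \<Sum>z\<in>A. f x y z"
  have "(\<Sum>y\<in>A. \<Sum>z\<in>A. (\<Sum>u\<in>A. f u y z) + (\<Sum>u\<in>A. f x u z) + (\<Sum>u\<in>A. f x y u))
      = (\<Sum>y\<in>A. \<Sum>z\<in>A. \<gamma> + \<theta> * f x y z)"
    using f \<open>x \<in> A\<close> by (intro sum.cong refl) auto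
  moreover have "(\<Sum>y\<in>A. \<Sum>z\<in>A. \<Sum>u\<in>A. f u y z) = (\<Sum>u\<in>A. \<Sum>y\<in>A. \<Sum>z\<in>A. f u y z)"
  proof -
    have "(\<Sum>y\<in>A. \<Sum>z\<in>A. \<Sum>u\<in>A. f u y z) = (\<Sum>y\<in>A. \<Sum>u\<in>A. \<Sum>z\<in>A. f u y z)"
      by (intro sum.cong refl sum.swap)
    also have "\<dots> = (\<Sum>u\<in>A. \<Sum>y\<in>A. \<Sum>z\<in>A. f u y z)"
      by (rule sum.swap)
    finally show ?thesis .
  qed
  moreover have "(\<Sum>y\<in>A. \<Sum>z\<in>A. \<Sum>u\<in>A. f x u z) = q * ?P"
    using sum.swap[of "\<lambda>z u. f x u z" A A] by (simp add: q)
  moreover have "(\<Sum>y\<in>A. \<Sum>z\<in>A. \<Sum>u\<in>A. f x y u) = q * ?P"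
    by (simp add: q sum_distrib_left)
  moreover have "(\<Sum>y\<in>A. \<Sum>z\<in>A. \<gamma> + \<theta> * f x y z) = \<gamma> * q^2 + \<theta> * ?P"
    by (simp add: sum.distrib q sum_distrib_left power2_eq_square)
  ultimately show ?thesis
    by (simp add: sum.distrib algebra_simps)
qed

text \<open>The equation is summed over a line in the first direction. That direction contributes
  \<open>q\<close> times the line sum, while the other two sweep out the two coordinate planes
  through the line.\<close>

lemma line_sum_equation:
  fixes f :: "'a \<Rightarrow> 'a \<Rightarrow> 'a \<Rightarrow> int"
  assumes f: "\<And>x y z. x \<in> A \<Longrightarrow> y \<in> A \<Longrightarrow> z \<in> A \<Longrightarrow>
      (\<Sum>u\<in>A. f u y z) + (\<Sum>u\<in>A. f x u z) + (\<Sum>u\<in>A. f x y u) = \<gamma> + \<theta> * f x y z"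
    and "y \<in> A" "z \<in> A"
  shows "(q - \<theta>) * (\<Sum>x\<in>A. f x y z)
    = \<gamma> * q - (\<Sum>x\<in>A. \<Sum>u\<in>A. f x u z) - (\<Sum>x\<in>A. \<Sum>u\<in>A. f x y u)"
proof -
  have "(\<Sum>x\<in>A. (\<Sum>u\<in>A. f u y z) + (\<Sum>u\<in>A. f x u z) + (\<Sum>u\<in>A. f x y u))
      = (\<Sum>x\<in>A. \<gamma> + \<theta> * f x y z)"
    using f assms(2,3) by (intro sum.cong refl) auto
  also have "\<dots> = \<gamma> * q + \<theta> * (\<Sum>x\<in>A. f x y z)"
    by (simp add: sum.distrib q sum_distrib_left)
  finally show ?thesis
    by (simp add: sum.distrib q algebra_simps)
qed

text \<open>For \<theta> \<noteq> 2q, \<open>plane_sum_equation\<close> determines the plane sum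
  independently of \<open>x\<close>. So parallel planes have equal sums, and the total is
  \<open>q\<close> times one of them.\<close>

lemma plane_sum_eq:
  fixes f :: "'a \<Rightarrow> 'a \<Rightarrow> 'a \<Rightarrow> int"
  assumes f: "\<And>x y z. x \<in> A \<Longrightarrow> y \<in> A \<Longrightarrow> z \<in> A \<Longrightarrow>
      (\<Sum>u\<in>A. f u y z) + (\<Sum>u\<in>A. f x u z) + (\<Sum>u\<in>A. f x y u) = \<gamma> + \<theta> * f x y z"
    and "\<theta> \<noteq> 2 * q" "x \<in> A"
  shows "(3 * q - \<theta>) * (\<Sum>y\<in>A. \<Sum>z\<in>A. f x y z) = \<gamma> * q^2"
proof -
  let ?P = "\<lambda>x. \<Sum>y\<in>A. \<Sum>z\<in>A. f x y z"
  have "(2 * q - \<theta>) * ?P u = (2 * q - \<theta>) * ?P x" if "u \<in> A" for u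
    using plane_sum_equation[OF f] \<open>x \<in> A\<close> that by simp
  then have "?P u = ?P x" if "u \<in> A" for u
    using that \<open>\<theta> \<noteq> 2 * q\<close> by auto
  then have "(\<Sum>x\<in>A. ?P x) = q * ?P x"
    by (simp add: q)
  then show ?thesis
    using plane_sum_equation[OF f \<open>x \<in> A\<close>] by (simp add: algebra_simps)
qed

text \<open>For \<theta> \<noteq> 2q all plane sums in all directions equal one number
  \<open>p\<close>, so \<open>q - \<theta>\<close> times any line sum is
  \<open>\<gamma> * q - 2 * p\<close>. If \<theta> = q, this vanishes and
  \<open>\<gamma> * q\<close> is even. Otherwise all line sums agree, \<open>\<theta> * f\<close> is
  constant, and a nonconstant \<open>f\<close> forces \<theta> = 0; then \<gamma> is the sum of
  three equal line sums.\<close>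

lemma eigenfunction_cases:
  fixes f :: "'a \<Rightarrow> 'a \<Rightarrow> 'a \<Rightarrow> int"
  assumes f: "\<And>x y z. x \<in> A \<Longrightarrow> y \<in> A \<Longrightarrow> z \<in> A \<Longrightarrow>
      (\<Sum>u\<in>A. f u y z) + (\<Sum>u\<in>A. f x u z) + (\<Sum>u\<in>A. f x y u) = \<gamma> + \<theta> * f x y z"
    and nonconst: "x \<in> A" "y \<in> A" "z \<in> A" "x' \<in> A" "y' \<in> A" "z' \<in> A" "f x y z \<noteq> f x' y' z'"
    and \<theta>: "\<theta> \<noteq> 3 * q"
  shows "\<theta> = 2 * q \<or> \<theta> = q \<and> even (\<gamma> * q) \<or> \<theta> = 0 \<and> 3 dvd \<gamma>"
proof (cases "\<theta> = 2 * q")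
  case False
  have q0: "q \<noteq> 0" using fin nonconst(1) by (auto simp: q)
  note P1 = plane_sum_eq[OF f False]
  \<comment> \<open>The hypothesis is symmetric in the coordinates; these rearrangements match it
    with permuted arguments of \<open>f\<close>, which carries the results on planes and lines over
    to the other two directions.\<close>
  have g: "(\<Sum>u\<in>A. f x u z) + (\<Sum>u\<in>A. f u y z) + (\<Sum>u\<in>A. f x y u) = \<gamma> + \<theta> * f x y z"
    "(\<Sum>u\<in>A. f x y u) + (\<Sum>u\<in>A. f u y z) + (\<Sum>u\<in>A. f x u z) = \<gamma> + \<theta> * f x y z"
    if "x \<in> A" "y \<in> A" "z \<in> A" for x y z
    using f that by (simp_all add: algebra_simps)
  note P2 = plane_sum_eq[of "\<lambda>y x z. f x y z", OF g(1) False]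
  note P3 = plane_sum_eq[of "\<lambda>z x y. f x y z", OF g(2) False]
  define p where "p = (\<Sum>y\<in>A. \<Sum>z\<in>A. f x y z)"
  have p: "(3 * q - \<theta>) * p = \<gamma> * q^2" unfolding p_def using P1 nonconst by simp
  have cancel: "t = p" if "(3 * q - \<theta>) * t = \<gamma> * q^2" for t
    using that \<theta> unfolding p[symmetric] by simp
  have planes: "(\<Sum>y\<in>A. \<Sum>z\<in>A. f x y z) = p" "(\<Sum>u\<in>A. \<Sum>z\<in>A. f u x z) = p"
    "(\<Sum>u\<in>A. \<Sum>y\<in>A. f u y x) = p" if "x \<in> A" for x
    using P1[OF _ _ _ that] P2[OF _ _ _ that] P3[OF _ _ _ that] by (intro cancel; simp)+
  have planes': "(\<Sum>z\<in>A. \<Sum>y\<in>A. f x y z) = p" "(\<Sum>z\<in>A. \<Sum>u\<in>A. f u x z) = p"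
    "(\<Sum>y\<in>A. \<Sum>u\<in>A. f u y x) = p" if "x \<in> A" for x
    by (subst sum.swap, simp add: planes that)+
  have l1: "(q - \<theta>) * (\<Sum>u\<in>A. f u y z) = \<gamma> * q - 2 * p" if "y \<in> A" "z \<in> A" for y z
    using line_sum_equation[OF f that] planes that by simp
  have l2: "(q - \<theta>) * (\<Sum>u\<in>A. f x u z) = \<gamma> * q - 2 * p" if "x \<in> A" "z \<in> A" for x z
    using line_sum_equation[of "\<lambda>y x z. f x y z", OF g(1) that] planes planes' that by simp
  have l3: "(q - \<theta>) * (\<Sum>u\<in>A. f x y u) = \<gamma> * q - 2 * p" if "x \<in> A" "y \<in> A" for x y
    using line_sum_equation[of "\<lambda>z x y. f x y z", OF g(2) that] planes' that by simp
  show ?thesis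
  proof (cases "\<theta> = q")
    case True
    then show ?thesis using l1 nonconst by (metis dvd_triv_left eq_iff_diff_eq_0 mult_zero_left)
  next
    case False
    define m where "m = (\<Sum>u\<in>A. f u y z)"
    have M: "(q - \<theta>) * m = \<gamma> * q - 2 * p" using l1 nonconst m_def by simp
    have cancel: "t = m" if "(q - \<theta>) * t = \<gamma> * q - 2 * p" for t
      using that False unfolding M[symmetric] by simp
    have lines: "(\<Sum>u\<in>A. f u y z) = m" "(\<Sum>u\<in>A. f y u z) = m" "(\<Sum>u\<in>A. f y z u) = m"
      if "y \<in> A" "z \<in> A" for y z
      using l1[OF that] l2[OF that] l3[OF that] by (intro cancel; simp)+
    have "\<theta> * f x y z = 3 * m - \<gamma>" "\<theta> * f x' y' z' = 3 * m - \<gamma>"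
      using f[of x y z] f[of x' y' z'] lines nonconst by auto
    then have "\<theta> = 0" using nonconst(7) by (metis mult_left_cancel)
    then show ?thesis using \<open>\<theta> * f x y z = 3 * m - \<gamma>\<close> by (auto intro: dvdI[of _ _ m])
  qed
qed simp

end

section \<open>Unions of disjoint lines\<close>

text \<open>\<open>L\<^sub>1\<close>, \<open>L\<^sub>2\<close>, \<open>L\<^sub>3\<close> index families of lines in the three coordinate directions;
  a line is indexed by its two constant coordinates.\<close>

definition disjoint_lines ::
    "'a set \<Rightarrow> ('a \<Rightarrow> 'a \<Rightarrow> bool) \<Rightarrow> ('a \<Rightarrow> 'a \<Rightarrow> bool) \<Rightarrow> ('a \<Rightarrow> 'a \<Rightarrow> bool) \<Rightarrow> bool" where
  "disjoint_lines A L1 L2 L3 \<longleftrightarrow> (\<forall>x\<in>A. \<forall>y\<in>A. \<forall>z\<in>A.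
     \<not> (L1 y z \<and> L2 x z) \<and> \<not> (L1 y z \<and> L3 x y) \<and> \<not> (L2 x z \<and> L3 x y))"

text \<open>A line either belongs to the family of its own direction, and then disjointness keeps
  all other chosen lines away from it, or it meets the chosen lines of the other two directions in
  distinct single points. Reading \<open>L1\<close>, \<open>L2\<close>, \<open>L3\<close> as
  bipartite graphs, the counts regroup into the total degrees of \<open>x\<close>, \<open>y\<close>
  and \<open>z\<close>.\<close>

lemma line_sums_disjoint_lines:
  assumes "finite A" and disj: "disjoint_lines A L1 L2 L3" and xyz: "x \<in> A" "y \<in> A" "z \<in> A"
  defines "P \<equiv> \<lambda>x y z. L1 y z \<or> L2 x z \<or> L3 x y"
  shows "card {u \<in> A. P u y z} + card {u \<in> A. P x u z} + card {u \<in> A. P x y u}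
    = card A * of_bool (P x y z)
      + (card {u \<in> A. L2 x u} + card {u \<in> A. L3 x u})
      + (card {u \<in> A. L1 y u} + card {u \<in> A. L3 u y})
      + (card {u \<in> A. L1 u z} + card {u \<in> A. L2 u z})"
proof -
  have *: "card {u \<in> A. b \<or> Q u \<or> R u}
      = card A * of_bool b + card {u \<in> A. Q u} + card {u \<in> A. R u}"
    if "\<And>u. u \<in> A \<Longrightarrow> \<not> (b \<and> Q u) \<and> \<not> (b \<and> R u) \<and> \<not> (Q u \<and> R u)" for b Q R
  proof (cases b)
    case True
    then have e: "{u \<in> A. Q u} = {}" "{u \<in> A. R u} = {}" using that by auto
    show ?thesis unfolding e using True by simp
  next
    case False
    have "{u \<in> A. b \<or> Q u \<or> R u} = {u \<in> A. Q u} \<union> {u \<in> A. R u}" using False by auto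
    moreover have "{u \<in> A. Q u} \<inter> {u \<in> A. R u} = {}" using that by auto
    ultimately show ?thesis
      using False assms(1) by (simp add: card_Un_disjoint)
  qed
  have d: "\<And>x y z. x \<in> A \<Longrightarrow> y \<in> A \<Longrightarrow> z \<in> A \<Longrightarrow>
     \<not> (L1 y z \<and> L2 x z) \<and> \<not> (L1 y z \<and> L3 x y) \<and> \<not> (L2 x z \<and> L3 x y)"
    using disj by (simp add: disjoint_lines_def)
  have "card {u \<in> A. P u y z}
      = card A * of_bool (L1 y z) + card {u \<in> A. L2 u z} + card {u \<in> A. L3 u y}"
    unfolding P_def using xyz d by (intro *) blast
  moreover have "card {u \<in> A. L2 x z \<or> L1 u z \<or> L3 x u}
      = card A * of_bool (L2 x z) + card {u \<in> A. L1 u z} + card {u \<in> A. L3 x u}"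
    using xyz d by (intro *) blast
  then have "card {u \<in> A. P x u z}
      = card A * of_bool (L2 x z) + card {u \<in> A. L1 u z} + card {u \<in> A. L3 x u}"
    by (simp add: P_def disj_ac)
  moreover have "card {u \<in> A. L3 x y \<or> L1 y u \<or> L2 x u}
      = card A * of_bool (L3 x y) + card {u \<in> A. L1 y u} + card {u \<in> A. L2 x u}"
    using xyz d by (intro *) blast
  then have "card {u \<in> A. P x y u}
      = card A * of_bool (L3 x y) + card {u \<in> A. L1 y u} + card {u \<in> A. L2 x u}"
    by (simp add: P_def disj_ac)
  moreover have "of_bool (P x y z)
      = of_bool (L1 y z) + of_bool (L2 x z) + (of_bool (L3 x y) :: nat)"
    using d[OF xyz] by (auto simp: P_def)
  ultimately show ?thesis by (simp add: algebra_simps)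
qed

text \<open>The case \<theta> = q of the line sum criterion: the total degree is the constant
  \<open>g\<close>. The bound \<open>g < 2 * card A\<close> makes \<beta> positive.\<close>

lemma code_of_disjoint_lines:
  assumes "finite A" "A \<noteq> {}" "disjoint_lines A L1 L2 L3" "g \<ge> 1" "g < 2 * card A"
    and deg: "\<And>x y z. x \<in> A \<Longrightarrow> y \<in> A \<Longrightarrow> z \<in> A \<Longrightarrow>
      (card {u \<in> A. L2 x u} + card {u \<in> A. L3 x u})
      + (card {u \<in> A. L1 y u} + card {u \<in> A. L3 u y})
      + (card {u \<in> A. L1 u z} + card {u \<in> A. L2 u z}) = g"
  shows "\<exists>C. completely_regular_code A C (2 * int (card A) - int g) (int g)"
proof (rule completely_regular_codeI[where P = "\<lambda>x y z. L1 y z \<or> L2 x z \<or> L3 x y"])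
  fix x y z assume xyz: "x \<in> A" "y \<in> A" "z \<in> A"
  show "int (card {u \<in> A. L1 y z \<or> L2 u z \<or> L3 u y})
      + int (card {u \<in> A. L1 u z \<or> L2 x z \<or> L3 x u})
      + int (card {u \<in> A. L1 y u \<or> L2 x u \<or> L3 x y})
    = (if L1 y z \<or> L2 x z \<or> L3 x y then 3 * int (card A) - (2 * int (card A) - int g) else int g)"
    using line_sums_disjoint_lines[OF assms(1,3) xyz] deg[OF xyz] by auto
qed (use assms in auto)

section \<open>Existence\<close>

lemma mod_add_left_cancel_nat:
  "(a + d) mod m = (a + e) mod m \<longleftrightarrow> d mod m = e mod (m::nat)"
proof -
  have "int ((a + d) mod m) = int ((a + e) mod m) \<longleftrightarrow> int (d mod m) = int (e mod m)"
    by (simp add: zmod_int mod_eq_dvd_iff)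
  then show ?thesis by (simp only: of_nat_eq_iff)
qed

lemma card_residue_class:
  assumes "y < (m::nat)"
  shows "card {l. l < m * k \<and> l mod m = y} = k"
proof -
  have "bij_betw (\<lambda>i. i * m + y) {..<k} {l. l < m * k \<and> l mod m = y}"
  proof (rule bij_betw_byWitness[where f' = "\<lambda>l. l div m"])
    show "(\<lambda>i. i * m + y) ` {..<k} \<subseteq> {l. l < m * k \<and> l mod m = y}"
    proof safe
      fix i assume "i < k"
      then have "Suc i * m \<le> k * m" by (intro mult_right_mono) auto
      then show "i * m + y < m * k" using assms by (simp add: mult.commute)
    qed (use assms in simp)
    show "(\<lambda>l. l div m) ` {l. l < m * k \<and> l mod m = y} \<subseteq> {..<k}"
      by (auto simp: less_mult_imp_div_less mult.commute)
  qed (use assms in auto)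
  then show ?thesis using bij_betw_same_card by fastforce
qed

text \<open>The \<open>n * k\<close> edge slots are dealt out cyclically: slot \<open>p\<close>
  joins the left vertex \<open>p div k\<close> to the right vertex \<open>p mod m\<close>. As
  \<open>k \<le> m\<close>, the \<open>k\<close> consecutive slots of a left vertex have distinct
  residues, so no edge is repeated; each residue occurs \<open>l\<close> times among the
  \<open>m * l\<close> slots.\<close>

lemma biregular_relation_nat:
  fixes n m k l :: nat
  assumes "n * k = m * l" "k \<le> m"
  obtains E where "\<And>i. i < n \<Longrightarrow> card {j. j < m \<and> E i j} = k"
    and "\<And>j. j < m \<Longrightarrow> card {i. i < n \<and> E i j} = l"
proof -
  define E where "E i j \<longleftrightarrow> (\<exists>d<k. (i * k + d) mod m = j)" for i j
  have inj: "d = e" if "(a + d) mod m = (a + e) mod m" "d < k" "e < k" for a d e :: nat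
    using that \<open>k \<le> m\<close> by (auto simp: mod_add_left_cancel_nat)
  have "card {j. j < m \<and> E i j} = k" if "i < n" for i
  proof -
    have "{j. j < m \<and> E i j} = (\<lambda>d. (i * k + d) mod m) ` {..<k}"
      using \<open>k \<le> m\<close> by (auto simp: E_def)
    moreover have "inj_on (\<lambda>d. (i * k + d) mod m) {..<k}"
      by (auto intro!: inj_onI dest: inj)
    ultimately show ?thesis by (simp add: card_image)
  qed
  moreover have "card {i. i < n \<and> E i j} = l" if "j < m" for j
  proof -
    let ?R = "{p. p < m * l \<and> p mod m = j}"
    \<comment> \<open>The left neighbours of \<open>j\<close> are the blocks of the slots with
      residue \<open>j\<close>, and a block contains at most one such slot.\<close>
    have "{i. i < n \<and> E i j} = (\<lambda>p. p div k) ` ?R"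
    proof safe
      fix i assume "i < n" "E i j"
      then obtain d where d: "d < k" "(i * k + d) mod m = j" by (auto simp: E_def)
      have "Suc i * k \<le> n * k" using \<open>i < n\<close> by (intro mult_right_mono) auto
      then have "i * k + d < m * l" using d assms(1) by simp
      then show "i \<in> (\<lambda>p. p div k) ` ?R"
        using d by (intro image_eqI[of _ _ "i * k + d"]) auto
    next
      fix p assume p: "p < m * l" "j = p mod m"
      then have "k > 0" using assms(1) by (cases k) auto
      show "p div k < n" using p assms(1) by (simp add: less_mult_imp_div_less)
      show "E (p div k) (p mod m)"
        unfolding E_def using \<open>k > 0\<close> by (intro exI[of _ "p mod k"]) simp
    qed
    moreover have "inj_on (\<lambda>p. p div k) ?R"
    proof (rule inj_onI)
      fix p p' assume p: "p \<in> ?R" "p' \<in> ?R" "p div k = p' div k"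
      then have "k > 0" using assms(1) by (cases k) auto
      have "(p div k * k + p mod k) mod m = (p div k * k + p' mod k) mod m"
        using p by (simp add: p(3)[symmetric]) (metis div_mult_mod_eq p(3))
      then have "p mod k = p' mod k" by (rule inj) (use \<open>k > 0\<close> in auto)
      then show "p = p'" using p(3) by (metis div_mult_mod_eq)
    qed
    ultimately show ?thesis using card_residue_class[OF that] by (simp add: card_image)
  qed
  ultimately show ?thesis using that by blast
qed

text \<open>Transfer to finite parts along enumerations. The relation is empty off
  \<open>X \<times> Y\<close>, so degrees can be counted over all of \<open>A\<close>.\<close>

lemma biregular_relation:
  assumes "finite A" "X \<subseteq> A" "Y \<subseteq> A" "card X * k = card Y * l" "k \<le> card Y"
  obtains E where "\<And>x y. E x y \<Longrightarrow> x \<in> X \<and> y \<in> Y"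
    and "\<And>x. card {y \<in> A. E x y} = (if x \<in> X then k else 0)"
    and "\<And>y. card {x \<in> A. E x y} = (if y \<in> Y then l else 0)"
proof -
  obtain E where E: "\<And>i. i < card X \<Longrightarrow> card {j. j < card Y \<and> E i j} = k"
    "\<And>j. j < card Y \<Longrightarrow> card {i. i < card X \<and> E i j} = l"
    using biregular_relation_nat[OF assms(4,5)] by metis
  obtain f g where f: "bij_betw f X {0..<card X}" and g: "bij_betw g Y {0..<card Y}"
    using assms(1-3) ex_bij_betw_finite_nat finite_subset by metis
  define F where "F x y \<longleftrightarrow> x \<in> X \<and> y \<in> Y \<and> E (f x) (g y)" for x y
  have "card {y \<in> A. F x y} = (if x \<in> X then k else 0)" for x
  proof (cases "x \<in> X")
    case True
    have "bij_betw g {y \<in> A. F x y} {j. j < card Y \<and> E (f x) j}"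
      using g True assms(3)
      by (auto simp: F_def bij_betw_def inj_on_def image_iff)
         (metis atLeastLessThan_iff imageE le0 subsetD)+
    then show ?thesis
      using True E(1)[of "f x"] bij_betw_apply[OF f True]
      by (simp add: bij_betw_same_card bij_betw_apply)
  qed (simp add: F_def)
  moreover have "card {x \<in> A. F x y} = (if y \<in> Y then l else 0)" for y
  proof (cases "y \<in> Y")
    case True
    have "bij_betw f {x \<in> A. F x y} {i. i < card X \<and> E i (g y)}"
      using f True assms(2)
      by (auto simp: F_def bij_betw_def inj_on_def image_iff)
         (metis atLeastLessThan_iff imageE le0 subsetD)+
    then show ?thesis
      using True E(2)[of "g y"] bij_betw_apply[OF g True]
      by (simp add: bij_betw_same_card bij_betw_apply)
  qed (simp add: F_def)
  ultimately show ?thesis using that[of F] F_def by blast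
qed

section \<open>Codes for each of the three eigenvalues\<close>

text \<open>The code is \<open>B \<times> A \<times> A\<close> with \<open>g\<close> elements in
  \<open>B\<close>: lines in the first direction contain \<open>g\<close> of its points, all other
  lines are full or empty.\<close>

lemma code_eigenvalue1_exists:
  assumes "finite A" "g \<ge> 1" "g < card A"
  shows "\<exists>C. completely_regular_code A C (int (card A) - int g) (int g)"
proof -
  obtain B where B: "B \<subseteq> A" "card B = g"
    using assms obtain_subset_with_card_n[of g A] by auto
  have "{u \<in> A. u \<in> B} = B" using B by auto
  then show ?thesis
    using assms B by (intro completely_regular_codeI[where P = "\<lambda>x _ _. x \<in> B"]) auto
qed

text \<open>The code consists of the cells with entry below \<open>k\<close> in a cyclic Latin cube.
  Along every line each residue occurs exactly once, so every line contains \<open>k\<close> points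
  of the code.\<close>

lemma code_eigenvalue3_exists:
  assumes "finite A" "k \<ge> 1" "k < card A"
  shows "\<exists>C. completely_regular_code A C (3 * int (card A) - 3 * int k) (3 * int k)"
proof -
  define q where "q = card A"
  obtain h where h: "bij_betw h A {0..<q}"
    using ex_bij_betw_finite_nat[OF assms(1)] by (auto simp: q_def)
  have count: "card {u \<in> A. (h u + d) mod q < k} = k" for d
  proof -
    have inj: "inj_on (\<lambda>u. (h u + d) mod q) A"
    proof (rule inj_onI)
      fix u v assume uv: "u \<in> A" "v \<in> A" "(h u + d) mod q = (h v + d) mod q"
      then have "h u < q" "h v < q" using h by (auto dest: bij_betwE)
      then have "h u = h v" using uv(3) mod_add_left_cancel_nat[of d "h u" q "h v"]
        by (simp add: add.commute)
      then show "u = v" using h uv by (auto simp: bij_betw_def inj_on_def)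
    qed
    have "(\<lambda>u. (h u + d) mod q) ` A \<subseteq> {..<q}"
      using assms by (auto simp: q_def)
    then have img: "(\<lambda>u. (h u + d) mod q) ` A = {..<q}"
      using inj by (intro card_subset_eq) (auto simp: card_image q_def)
    have "(\<lambda>u. (h u + d) mod q) ` {u \<in> A. (h u + d) mod q < k}
        = (\<lambda>u. (h u + d) mod q) ` A \<inter> {..<k}" by auto
    also have "\<dots> = {..<k}" unfolding img using assms(3) by (auto simp: q_def)
    finally have "card ((\<lambda>u. (h u + d) mod q) ` {u \<in> A. (h u + d) mod q < k}) = k" by simp
    then show ?thesis
      using inj by (metis (no_types, lifting) card_image inj_on_subset mem_Collect_eq subsetI)
  qed
  show ?thesis
  proof (rule completely_regular_codeI[where P = "\<lambda>x y z. (h x + h y + h z) mod q < k"])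
    fix x y z
    show "int (card {u \<in> A. (h u + h y + h z) mod q < k})
        + int (card {u \<in> A. (h x + h u + h z) mod q < k})
        + int (card {u \<in> A. (h x + h y + h u) mod q < k})
      = (if (h x + h y + h z) mod q < k then 3 * int (card A) - (3 * int (card A) - 3 * int k)
         else 3 * int k)"
      using count[of "h y + h z"] count[of "h x + h z"] count[of "h x + h y"]
      by (simp add: ac_simps)
  qed (use assms in auto)
qed

text \<open>Parallel lines over the edges of a \<open>k\<close>-regular bipartite graph between two
  copies of \<open>A\<close>; an edge slot at either end contributes \<open>k\<close> to
  \<gamma>.\<close>

lemma code_eigenvalue2_even_exists:
  assumes "finite A" "A \<noteq> {}" "k \<ge> 1" "k < card A"
  shows "\<exists>C. completely_regular_code A C (2 * int (card A) - 2 * int k) (2 * int k)"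
proof -
  obtain E where E: "\<And>x. card {y \<in> A. E x y} = (if x \<in> A then k else 0)"
    "\<And>y. card {x \<in> A. E x y} = (if y \<in> A then k else 0)"
    using biregular_relation[of A A A k k] assms by (metis less_imp_le order_refl)
  have "\<exists>C. completely_regular_code A C (2 * int (card A) - int (2 * k)) (int (2 * k))"
    by (rule code_of_disjoint_lines[where ?L1.0 = "\<lambda>_ _. False" and ?L2.0 = "\<lambda>_ _. False"
          and ?L3.0 = E]) (use assms E in \<open>auto simp: disjoint_lines_def\<close>)
  then show ?thesis by simp
qed

text \<open>Biregular graphs are placed on \<open>R \<times> S\<close>,
  \<open>(A - R) \<times> T\<close> and \<open>(A - S) \<times> (A - T)\<close>. Any two of them use
  complementary sets in the coordinate they share, so the lines are disjoint. Every \<open>x\<close>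
  has degree \<open>c\<close>, every \<open>y\<close> degree \<open>a\<close> and every
  \<open>z\<close> degree \<open>b\<close>, which add up to \<gamma>.\<close>

lemma code_eigenvalue2_condition1_exists:
  assumes "finite A" "condition1 (card A) \<gamma>" "\<gamma> < 2 * int (card A)"
  shows "\<exists>C. completely_regular_code A C (2 * int (card A) - \<gamma>) \<gamma>"
proof -
  let ?q = "card A"
  from assms(2) obtain r s t a b c :: int where "0 < r" "r < int ?q" "0 < s" "s < int ?q"
    "0 < t" "t < int ?q" "0 < c" "c \<le> min (int ?q - s) (int ?q - t)"
    "0 < b" "b \<le> min t (int ?q - r)" "0 < a" "a \<le> min r s"
    "c * r = a * (int ?q - t)" "b * (int ?q - s) = c * (int ?q - r)" "a * t = b * s"
    "\<gamma> = a + b + c"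
    unfolding condition1_def by blast
  note h = this
  obtain r' s' t' a' b' c' :: nat where n: "r = int r'" "s = int s'" "t = int t'"
    "a = int a'" "b = int b'" "c = int c'"
    using h(1,3,5,7,9,11) by (metis less_imp_le zero_le_imp_eq_int)
  have le: "r' \<le> ?q" "?q - t' \<le> ?q" "?q - s' \<le> ?q" "s' \<le> ?q" "t' \<le> ?q"
    using h n by auto
  obtain R S T where R: "R \<subseteq> A" "card R = r'" and S: "S \<subseteq> A" "card S = ?q - t'"
    and T: "T \<subseteq> A" "card T = ?q - s'"
    using le obtain_subset_with_card_n by metis
  have co: "card (A - R) = ?q - r'" "card (A - S) = t'" "card (A - T) = s'"
    using R S T le assms(1) by (auto simp: card_Diff_subset finite_subset)
  \<comment> \<open>The three equations of Condition 1 are the edge counts of the three graphs from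
    both sides.\<close>
  have "int (card R * c') = int (card S * a')" "int (card (A - R) * c') = int (card T * b')"
    "int (card (A - S) * a') = int (card (A - T) * b')"
    using h(13-15) le by (simp_all add: R S T co n of_nat_diff mult.commute)
  then have e: "card R * c' = card S * a'" "card (A - R) * c' = card T * b'"
    "card (A - S) * a' = card (A - T) * b'"
    by (simp_all only: of_nat_eq_iff)
  have b: "c' \<le> card S" "c' \<le> card T" "a' \<le> card (A - T)"
    using h S T co n by auto
  obtain L3 where L3: "\<And>x y. L3 x y \<Longrightarrow> x \<in> R \<and> y \<in> S"
    "\<And>x. card {y \<in> A. L3 x y} = (if x \<in> R then c' else 0)"
    "\<And>y. card {x \<in> A. L3 x y} = (if y \<in> S then a' else 0)"
    by (rule biregular_relation[OF assms(1) R(1) S(1) e(1) b(1)]) (rule that)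
  obtain L2 where L2: "\<And>x z. L2 x z \<Longrightarrow> x \<in> A - R \<and> z \<in> T"
    "\<And>x. card {z \<in> A. L2 x z} = (if x \<in> A - R then c' else 0)"
    "\<And>z. card {x \<in> A. L2 x z} = (if z \<in> T then b' else 0)"
    by (rule biregular_relation[OF assms(1) Diff_subset T(1) e(2) b(2)]) (rule that)
  obtain L1 where L1: "\<And>y z. L1 y z \<Longrightarrow> y \<in> A - S \<and> z \<in> A - T"
    "\<And>y. card {z \<in> A. L1 y z} = (if y \<in> A - S then a' else 0)"
    "\<And>z. card {y \<in> A. L1 y z} = (if z \<in> A - T then b' else 0)"
    by (rule biregular_relation[OF assms(1) Diff_subset Diff_subset e(3) b(3)]) (rule that)
  have "disjoint_lines A L1 L2 L3"
    unfolding disjoint_lines_def using L1(1) L2(1) L3(1) by blast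
  moreover have "A \<noteq> {}" using h by auto
  moreover have "\<gamma> = int (a' + b' + c')" using h n by simp
  ultimately show ?thesis
    using code_of_disjoint_lines[of A L1 L2 L3 "a' + b' + c'"] assms(1,3) h L1 L2 L3 n by simp
qed

text \<open>In the first direction the lines are full over the two graphs, half full over
  \<open>S \<times> T\<close> and \<open>(A - S) \<times> (A - T)\<close>, and empty elsewhere. The
  line sums balance when \<open>2 * l + s = g\<close> and \<open>2 * k + (2 * h - s) = g\<close>,
  which together give \<open>h + k + l = g\<close>.\<close>

lemma code_eigenvalue2_half_exists:
  assumes "finite A" "card A = 2 * h" "odd g" "h \<le> g" "g \<le> 2 * h"
  shows "\<exists>C. completely_regular_code A C (2 * int (card A) - int g) (int g)"
proof -
  have "h > 0" using assms(3,5) by (cases h) auto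
  \<comment> \<open>Oddness makes \<open>g - s\<close> and \<open>g + s\<close> even;
    \<open>s \<le> g\<close> and \<open>2 * h \<le> g + s\<close> keep \<open>l\<close> and
    \<open>k\<close> nonnegative. The odd one of \<open>h\<close> and \<open>h + 1\<close> works: if
    \<open>h\<close> is even, then \<open>h < g\<close> because \<open>g\<close> is odd.\<close>
  obtain s where s: "odd s" "s \<le> g" "2 * h \<le> g + s" "s \<le> 2 * h"
  proof (cases "odd h")
    case True
    then show ?thesis using assms by (intro that[of h]) auto
  next
    case False
    then have "h \<noteq> g" using assms(3) by auto
    then show ?thesis using False assms \<open>h > 0\<close> by (intro that[of "h + 1"]) auto
  qed
  obtain l where l: "g = s + 2 * l"
    using s(1,2) assms(3) by (metis dvd_def even_diff_nat le_add_diff_inverse linorder_not_less odd_even_add)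
  obtain k where k: "g + s = 2 * h + 2 * k"
    using s(1,3) assms(3) by (metis dvd_def dvd_add_right_iff dvd_triv_left le_add_diff_inverse odd_even_add)
  obtain R S T where R: "R \<subseteq> A" "card R = h" and S: "S \<subseteq> A" "card S = s"
    and T: "T \<subseteq> A" "card T = 2 * h - s"
    using assms(2) s(4) obtain_subset_with_card_n[of _ A]
    by (metis diff_le_self le_add2 mult_2)
  have co: "card (A - R) = h" "card (A - S) = 2 * h - s" "card (A - T) = s"
    using R S T s(4) assms(1,2) by (auto simp: card_Diff_subset finite_subset)
  have eqs: "card S * k = card (A - T) * k" "card (A - S) * l = card T * l"
    and le: "k \<le> card (A - T)" "l \<le> card T"
    using S T co k l assms(5) s(4) by auto
  obtain E1 where E1: "\<And>y z. E1 y z \<Longrightarrow> y \<in> S \<and> z \<in> A - T"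
    "\<And>y. card {z \<in> A. E1 y z} = (if y \<in> S then k else 0)"
    "\<And>z. card {y \<in> A. E1 y z} = (if z \<in> A - T then k else 0)"
    by (rule biregular_relation[OF assms(1) S(1) Diff_subset eqs(1) le(1)]) (rule that)
  obtain E2 where E2: "\<And>y z. E2 y z \<Longrightarrow> y \<in> A - S \<and> z \<in> T"
    "\<And>y. card {z \<in> A. E2 y z} = (if y \<in> A - S then l else 0)"
    "\<And>z. card {y \<in> A. E2 y z} = (if z \<in> T then l else 0)"
    by (rule biregular_relation[OF assms(1) Diff_subset T(1) eqs(2) le(2)]) (rule that)
  \<comment> \<open>Lines over \<open>E1\<close> and \<open>E2\<close>, together with the boxes \<open>R \<times> S \<times> T\<close> and
    \<open>(A - R) \<times> (A - S) \<times> (A - T)\<close>. The parity of \<open>s\<close> makes the degrees \<open>k\<close>, \<open>l\<close> integral.\<close>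
  define P where "P x y z \<longleftrightarrow> E1 y z \<or> E2 y z \<or> x \<in> R \<and> y \<in> S \<and> z \<in> T
    \<or> x \<notin> R \<and> y \<notin> S \<and> z \<notin> T" for x y z
  have un: "card {u \<in> A. Q u \<or> Q' u} = card {u \<in> A. Q u} + card {u \<in> A. Q' u}"
    if "\<And>u. u \<in> A \<Longrightarrow> \<not> (Q u \<and> Q' u)" for Q Q'
  proof -
    have "{u \<in> A. Q u \<or> Q' u} = {u \<in> A. Q u} \<union> {u \<in> A. Q' u}" by auto
    moreover have "{u \<in> A. Q u} \<inter> {u \<in> A. Q' u} = {}" using that by auto
    ultimately show ?thesis using assms(1) by (simp add: card_Un_disjoint)
  qed
  have sets: "{u \<in> A. u \<in> R} = R" "{u \<in> A. u \<in> S} = S" "{u \<in> A. u \<in> T} = T"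
    "{u \<in> A. u \<notin> R} = A - R" "{u \<in> A. u \<notin> S} = A - S" "{u \<in> A. u \<notin> T} = A - T"
    using R S T by auto
  have l1: "card {u \<in> A. P u y z} = (if E1 y z \<or> E2 y z then 2 * h
      else if y \<in> S \<longleftrightarrow> z \<in> T then h else 0)" if "y \<in> A" "z \<in> A" for y z
    using E1(1) E2(1) assms(2) by (auto simp: P_def sets R co)
  have l2: "card {u \<in> A. P x u z} = (if z \<in> T then l + (if x \<in> R then s else 0)
      else k + (if x \<in> R then 0 else 2 * h - s))" if "z \<in> A" for x z
  proof (cases "z \<in> T")
    case True
    then have "{u \<in> A. P x u z} = {u \<in> A. E2 u z \<or> x \<in> R \<and> u \<in> S}"
      using E1(1) by (auto simp: P_def)
    also have "card \<dots> = card {u \<in> A. E2 u z} + card {u \<in> A. x \<in> R \<and> u \<in> S}"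
      using E2(1) by (intro un) auto
    finally show ?thesis using True by (simp add: E2 sets S)
  next
    case False
    then have "{u \<in> A. P x u z} = {u \<in> A. E1 u z \<or> x \<notin> R \<and> u \<notin> S}"
      using E2(1) by (auto simp: P_def)
    also have "card \<dots> = card {u \<in> A. E1 u z} + card {u \<in> A. x \<notin> R \<and> u \<notin> S}"
      using E1(1) by (intro un) auto
    finally show ?thesis using False that by (simp add: E1 sets co)
  qed
  have l3: "card {u \<in> A. P x y u} = (if y \<in> S then k + (if x \<in> R then 2 * h - s else 0)
      else l + (if x \<in> R then 0 else s))" if "y \<in> A" for x y
  proof (cases "y \<in> S")
    case True
    then have "{u \<in> A. P x y u} = {u \<in> A. E1 y u \<or> x \<in> R \<and> u \<in> T}"
      using E2(1) by (auto simp: P_def)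
    also have "card \<dots> = card {u \<in> A. E1 y u} + card {u \<in> A. x \<in> R \<and> u \<in> T}"
      using E1(1) by (intro un) auto
    finally show ?thesis using True by (simp add: E1 sets T)
  next
    case False
    then have "{u \<in> A. P x y u} = {u \<in> A. E2 y u \<or> x \<notin> R \<and> u \<notin> T}"
      using E1(1) by (auto simp: P_def)
    also have "card \<dots> = card {u \<in> A. E2 y u} + card {u \<in> A. x \<notin> R \<and> u \<notin> T}"
      using E2(1) by (intro un) auto
    finally show ?thesis using False that by (simp add: E2 sets co)
  qed
  show ?thesis
  proof (rule completely_regular_codeI[where P = P])
    fix x y z assume xyz: "x \<in> A" "y \<in> A" "z \<in> A"
    show "int (card {u \<in> A. P u y z}) + int (card {u \<in> A. P x u z}) + int (card {u \<in> A. P x y u})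
      = (if P x y z then 3 * int (card A) - (2 * int (card A) - int g) else int g)"
      unfolding l1[OF xyz(2,3)] l2[OF xyz(3)] l3[OF xyz(2)]
      using E1(1)[of y z] E2(1)[of y z] k l s(4)
      by (auto simp: P_def assms(2) of_nat_diff)
  qed (use assms \<open>h > 0\<close> in \<open>auto elim: oddE\<close>)
qed

section \<open>Necessity of Condition 1\<close>

lemma sum_card_swap:
  assumes "finite A"
  shows "(\<Sum>x\<in>A. card {y \<in> A. E x y}) = (\<Sum>y\<in>A. card {x \<in> A. E x y})"
proof -
  have *: "card {u \<in> A. Q u} = (\<Sum>u\<in>A. if Q u then 1 else 0)" for Q
    using assms by (simp add: sum.inter_filter[symmetric])
  show ?thesis unfolding * by (rule sum.swap)
qed

lemma biregular_card_eq:
  assumes "finite A" "X \<subseteq> A" "Y \<subseteq> A"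
    and "\<And>x. x \<in> A \<Longrightarrow> card {y \<in> A. E x y} = (if x \<in> X then k else 0)"
    and "\<And>y. y \<in> A \<Longrightarrow> card {x \<in> A. E x y} = (if y \<in> Y then l else 0)"
  shows "card X * k = card Y * l"
proof -
  have *: "(\<Sum>x\<in>A. if x \<in> Z then m else 0) = card Z * m" if "Z \<subseteq> A" for Z and m :: nat
    using assms(1) that by (simp add: sum.If_cases Int_absorb1)
  show ?thesis
    using sum_card_swap[OF assms(1), of E] assms(4,5) by (simp add: * assms(2,3))
qed

text \<open>Changing one coordinate at a time shows that the total degrees of \<open>x\<close>,
  \<open>y\<close> and \<open>z\<close> are separately constant. By disjointness, once every
  direction occurs, each coordinate value has edges in only one of its two graphs, which then
  carries its whole degree. This leaves three biregular graphs: their edge counts give the equations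
  of Condition 1, and degrees bounded by the opposite part give the inequalities.\<close>

lemma condition1_of_disjoint_lines:
  assumes fin: "finite A" and "A \<noteq> {}" and disj: "disjoint_lines A L1 L2 L3" and "odd g"
    and deg: "\<And>x y z. x \<in> A \<Longrightarrow> y \<in> A \<Longrightarrow> z \<in> A \<Longrightarrow>
      (card {u \<in> A. L2 x u} + card {u \<in> A. L3 x u})
      + (card {u \<in> A. L1 y u} + card {u \<in> A. L3 u y})
      + (card {u \<in> A. L1 u z} + card {u \<in> A. L2 u z}) = g"
  shows "condition1 (card A) (int g)"
proof -
  obtain p where p: "p \<in> A" using \<open>A \<noteq> {}\<close> by blast
  define \<alpha> where "\<alpha> = card {u \<in> A. L2 p u} + card {u \<in> A. L3 p u}"
  define \<sigma> where "\<sigma> = card {u \<in> A. L1 p u} + card {u \<in> A. L3 u p}"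
  define \<tau> where "\<tau> = card {u \<in> A. L1 u p} + card {u \<in> A. L2 u p}"
  have g: "g = \<alpha> + \<sigma> + \<tau>" using deg[OF p p p] by (simp add: \<alpha>_def \<sigma>_def \<tau>_def)
  have \<alpha>: "card {u \<in> A. L2 x u} + card {u \<in> A. L3 x u} = \<alpha>" if "x \<in> A" for x
    using deg[OF that p p] deg[OF p p p] by (simp add: \<alpha>_def)
  have \<sigma>: "card {u \<in> A. L1 y u} + card {u \<in> A. L3 u y} = \<sigma>" if "y \<in> A" for y
    using deg[OF p that p] deg[OF p p p] by (simp add: \<sigma>_def)
  have \<tau>: "card {u \<in> A. L1 u z} + card {u \<in> A. L2 u z} = \<tau>" if "z \<in> A" for z
    using deg[OF p p that] deg[OF p p p] by (simp add: \<tau>_def)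
  \<comment> \<open>The number of edges. Each coordinate is an endpoint in two of the graphs, so
    summing its constant degree over \<open>A\<close> counts the edges of both.\<close>
  define e where "e L = (\<Sum>x\<in>A. card {u \<in> A. L x u})" for L
  have e': "(\<Sum>y\<in>A. card {u \<in> A. L u y}) = e L" for L
    using sum_card_swap[OF fin, of L] by (simp add: e_def)
  have "e L2 + e L3 = card A * \<alpha>" "e L1 + e L3 = card A * \<sigma>" "e L1 + e L2 = card A * \<tau>"
    using sum.cong[OF refl \<alpha>, of A "\<lambda>x. x"] sum.cong[OF refl \<sigma>, of A "\<lambda>x. x"]
      sum.cong[OF refl \<tau>, of A "\<lambda>x. x"]
    by (simp_all add: sum.distrib e'[of L1] e'[of L2] e'[of L3]
        e_def[of L1, symmetric] e_def[of L2, symmetric] e_def[of L3, symmetric])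
  \<comment> \<open>If one of the three directions did not occur, one of the numbers
    \<open>\<alpha>\<close>, \<open>\<sigma>\<close>, \<open>\<tau>\<close> would be the sum of the other two, making \<open>g\<close> even.\<close>
  then have "e L1 = 0 \<Longrightarrow> card A * \<alpha> = card A * (\<sigma> + \<tau>)"
    "e L2 = 0 \<Longrightarrow> card A * \<sigma> = card A * (\<alpha> + \<tau>)"
    "e L3 = 0 \<Longrightarrow> card A * \<tau> = card A * (\<alpha> + \<sigma>)"
    by (simp_all add: algebra_simps)
  moreover have "card A \<noteq> 0" using p fin by auto
  ultimately have "e L1 = 0 \<Longrightarrow> g = 2 * \<alpha>" "e L2 = 0 \<Longrightarrow> g = 2 * \<sigma>" "e L3 = 0 \<Longrightarrow> g = 2 * \<tau>"
    using g by simp_all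
  then have "e L1 \<noteq> 0" "e L2 \<noteq> 0" "e L3 \<noteq> 0"
    using \<open>odd g\<close> by (metis dvd_triv_left)+
  then obtain y1 z1 x2 z2 x3 y3 where pts: "y1 \<in> A" "z1 \<in> A" "L1 y1 z1"
    "x2 \<in> A" "z2 \<in> A" "L2 x2 z2" "x3 \<in> A" "y3 \<in> A" "L3 x3 y3"
    unfolding e_def using fin by (auto simp: card_gt_0_iff)
  \<comment> \<open>The values that occur as endpoints. The three lines found above ensure that
    these sets and their complements are nonempty.\<close>
  define R where "R = {x \<in> A. \<exists>y\<in>A. L3 x y}"
  define S where "S = {y \<in> A. \<exists>x\<in>A. L3 x y}"
  define T where "T = {z \<in> A. \<exists>x\<in>A. L2 x z}"
  have sub: "R \<subseteq> A" "S \<subseteq> A" "T \<subseteq> A" by (auto simp: R_def S_def T_def)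
  have L3: "x \<in> R \<and> y \<in> S" if "L3 x y" "x \<in> A" "y \<in> A" for x y
    using that by (auto simp: R_def S_def)
  have L2: "x \<in> A - R \<and> z \<in> T" if "L2 x z" "x \<in> A" "z \<in> A" for x z
    using that disj by (auto simp: R_def T_def disjoint_lines_def)
  have L1: "y \<in> A - S \<and> z \<in> A - T" if "L1 y z" "y \<in> A" "z \<in> A" for y z
    using that disj by (auto simp: S_def T_def disjoint_lines_def)
  have empty: "card {u \<in> A. Q u} = 0" if "\<And>u. u \<in> A \<Longrightarrow> Q u \<Longrightarrow> False" for Q
    using that by (auto simp: card_eq_0_iff)
  have "x \<in> A - R \<Longrightarrow> card {u \<in> A. L3 x u} = 0" "x \<in> R \<Longrightarrow> card {u \<in> A. L2 x u} = 0"
    if "x \<in> A" for x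
    using that by (auto intro!: empty dest: L3 L2)
  then have d3: "card {y \<in> A. L3 x y} = (if x \<in> R then \<alpha> else 0)"
    and d2: "card {z \<in> A. L2 x z} = (if x \<in> A - R then \<alpha> else 0)" if "x \<in> A" for x
    using \<alpha>[OF that] that by (auto split: if_split)
  have "y \<in> A - S \<Longrightarrow> card {u \<in> A. L3 u y} = 0" "y \<in> S \<Longrightarrow> card {u \<in> A. L1 y u} = 0"
    if "y \<in> A" for y
    using that by (auto intro!: empty dest: L3 L1)
  then have d3': "card {x \<in> A. L3 x y} = (if y \<in> S then \<sigma> else 0)"
    and d1: "card {z \<in> A. L1 y z} = (if y \<in> A - S then \<sigma> else 0)" if "y \<in> A" for y
    using \<sigma>[OF that] that by (auto split: if_split)
  have "z \<in> A - T \<Longrightarrow> card {u \<in> A. L2 u z} = 0" "z \<in> T \<Longrightarrow> card {u \<in> A. L1 u z} = 0"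
    if "z \<in> A" for z
    using that by (auto intro!: empty dest: L2 L1)
  then have d2': "card {x \<in> A. L2 x z} = (if z \<in> T then \<tau> else 0)"
    and d1': "card {y \<in> A. L1 y z} = (if z \<in> A - T then \<tau> else 0)" if "z \<in> A" for z
    using \<tau>[OF that] that by (auto split: if_split)
  have e3: "card R * \<alpha> = card S * \<sigma>"
    using biregular_card_eq[OF fin sub(1,2) d3 d3'] by simp
  have e2: "card (A - R) * \<alpha> = card T * \<tau>"
    using biregular_card_eq[OF fin Diff_subset sub(3) d2 d2'] by simp
  have e1: "card (A - S) * \<sigma> = card (A - T) * \<tau>"
    using biregular_card_eq[OF fin Diff_subset Diff_subset d1 d1'] by simp
  have bound: "card {u \<in> A. Q u} \<le> card Z" if "\<And>u. u \<in> A \<Longrightarrow> Q u \<Longrightarrow> u \<in> Z" "Z \<subseteq> A" for Q Z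
    using that fin by (intro card_mono) (auto intro: finite_subset)
  \<comment> \<open>Each bound is read off at an endpoint of one of the known edges, whose
    neighbours all lie in the opposite part.\<close>
  have le: "\<alpha> \<le> card S" "\<alpha> \<le> card T" "\<sigma> \<le> card R" "\<sigma> \<le> card (A - T)"
    "\<tau> \<le> card (A - R)" "\<tau> \<le> card (A - S)"
    using bound[of "L3 x3" S] d3[of x3] bound[of "L2 x2" T] d2[of x2]
      bound[of "\<lambda>u. L3 u y3" R] d3'[of y3] bound[of "L1 y1" "A - T"] d1[of y1]
      bound[of "\<lambda>u. L2 u z2" "A - R"] d2'[of z2] bound[of "\<lambda>u. L1 u z1" "A - S"] d1'[of z1]
      pts L1[OF pts(3,1,2)] L2[OF pts(6,4,5)] L3[OF pts(9,7,8)] L1 L2 L3 sub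
    by (simp_all split: if_splits)
  have pos: "\<alpha> > 0" "\<sigma> > 0" "\<tau> > 0"
    using \<alpha>[OF pts(7)] \<sigma>[OF pts(8)] \<tau>[OF pts(5)] pts fin by (auto simp: card_eq_0_iff)
  have cpos: "card Z > 0" if "u \<in> Z" "Z \<subseteq> A" for u Z
    using that fin by (auto simp: card_gt_0_iff intro: finite_subset)
  have co: "card A = card Z + card (A - Z)" if "Z \<subseteq> A" for Z
    using that fin by (metis add.commute card_Diff_subset card_mono finite_subset le_add_diff_inverse2)
  have ico: "int (card A) - int (card Z) = int (card (A - Z))"
      "int (card A) - int (card (A - Z)) = int (card Z)" if "Z \<subseteq> A" for Z
    using co[OF that] by simp_all
  have gt: "card R > 0" "card (A - R) > 0" "card S > 0" "card (A - S) > 0" "card T > 0"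
    "card (A - T) > 0"
    using L1[OF pts(3,1,2)] L2[OF pts(6,4,5)] L3[OF pts(9,7,8)] cpos sub by (meson Diff_subset)+
  have lt: "card R < card A" "card (A - T) < card A" "card (A - S) < card A"
    using gt co[OF sub(1)] co[OF sub(2)] co[OF sub(3)] by auto
  show ?thesis
    unfolding condition1_def
    \<comment> \<open>In the notation of the definition, \<open>\<alpha>\<close>, \<open>\<sigma>\<close>, \<open>\<tau>\<close> are \<open>c\<close>, \<open>a\<close>, \<open>b\<close>.\<close>
    apply (rule exI[of _ "int (card R)"], rule exI[of _ "int (card (A - T))"],
        rule exI[of _ "int (card (A - S))"], rule exI[of _ "int \<sigma>"], rule exI[of _ "int \<tau>"],
        rule exI[of _ "int \<alpha>"])
    using e1 e2 e3 le pos gt lt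
    by (simp add: ico[OF sub(1)] ico[OF sub(2)] ico[OF sub(3)] g mult.commute
        flip: of_nat_mult)
qed

text \<open>The families \<open>L1\<close>, \<open>L2\<close>, \<open>L3\<close> consist of the full
  lines contained in \<open>C\<close>. For \<open>2 * g < card A\<close> they are disjoint and cover
  \<open>C\<close>, which reduces the claim to \<open>condition1_of_disjoint_lines\<close>.\<close>

lemma condition1_necessary:
  assumes fin: "finite A" and C: "completely_regular_code A C (2 * int (card A) - int g) (int g)"
    and "odd g" "2 * g < card A"
  shows "condition1 (card A) (int g)"
proof -
  have "int (card {u \<in> A. (u, y, z) \<in> C}) + int (card {u \<in> A. (x, u, z) \<in> C})
        + int (card {u \<in> A. (x, y, u) \<in> C})
      = int ((if (x, y, z) \<in> C then card A else 0) + g)"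
    if "x \<in> A" "y \<in> A" "z \<in> A" for x y z
    using C that unfolding completely_regular_code_iff_line_sums[OF fin] by simp
  then have sums: "card {u \<in> A. (u, y, z) \<in> C} + card {u \<in> A. (x, u, z) \<in> C}
        + card {u \<in> A. (x, y, u) \<in> C} = (if (x, y, z) \<in> C then card A else 0) + g"
    if "x \<in> A" "y \<in> A" "z \<in> A" for x y z
    using that by (simp only: of_nat_add[symmetric] of_nat_eq_iff)
  define L1 where "L1 y z \<longleftrightarrow> (\<forall>u\<in>A. (u, y, z) \<in> C)" for y z
  define L2 where "L2 x z \<longleftrightarrow> (\<forall>u\<in>A. (x, u, z) \<in> C)" for x z
  define L3 where "L3 x y \<longleftrightarrow> (\<forall>u\<in>A. (x, y, u) \<in> C)" for x y
  have full: "card {u \<in> A. Q u} = card A" if "\<forall>u\<in>A. Q u" for Q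
    using that by (metis (mono_tags, lifting) Collect_cong Collect_mem_eq)
  \<comment> \<open>Two full lines through one vertex would make its line sum at least
    \<open>2 * card A\<close>, but it is at most \<open>card A + g\<close>.\<close>
  have disj: "disjoint_lines A L1 L2 L3"
    unfolding disjoint_lines_def
  proof (intro ballI)
    fix x y z assume xyz: "x \<in> A" "y \<in> A" "z \<in> A"
    show "\<not> (L1 y z \<and> L2 x z) \<and> \<not> (L1 y z \<and> L3 x y) \<and> \<not> (L2 x z \<and> L3 x y)"
      using sums[OF xyz] assms(4) full[of "\<lambda>u. (u, y, z) \<in> C"] full[of "\<lambda>u. (x, u, z) \<in> C"]
        full[of "\<lambda>u. (x, y, u) \<in> C"]
      by (auto simp: L1_def[symmetric] L2_def[symmetric] L3_def[symmetric] split: if_splits)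
  qed
  \<comment> \<open>A line that is not full meets the complement of \<open>C\<close> and thus has at most \<open>g\<close>
    points in \<open>C\<close>; three such lines through a point of \<open>C\<close> would give \<open>card A + g \<le> 3 * g\<close>.\<close>
  have iff: "(x, y, z) \<in> C \<longleftrightarrow> L1 y z \<or> L2 x z \<or> L3 x y"
    if xyz: "x \<in> A" "y \<in> A" "z \<in> A" for x y z
  proof
    assume "(x, y, z) \<in> C"
    show "L1 y z \<or> L2 x z \<or> L3 x y"
    proof (rule ccontr)
      assume "\<not> (L1 y z \<or> L2 x z \<or> L3 x y)"
      then obtain u v w where uvw: "u \<in> A" "v \<in> A" "w \<in> A"
        and "(u, y, z) \<notin> C" "(x, v, z) \<notin> C" "(x, y, w) \<notin> C"
        by (auto simp: L1_def L2_def L3_def)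
      then show False
        using sums[OF xyz] sums[of u y z] sums[of x v z] sums[of x y w] xyz
          \<open>(x, y, z) \<in> C\<close> assms(4) by simp
    qed
  qed (use xyz in \<open>auto simp: L1_def L2_def L3_def\<close>)
  show ?thesis
  proof (rule condition1_of_disjoint_lines[OF fin _ disj \<open>odd g\<close>])
    show "A \<noteq> {}" using assms(4) by auto
    fix x y z assume xyz: "x \<in> A" "y \<in> A" "z \<in> A"
    have eq: "{u \<in> A. (u, y, z) \<in> C} = {u \<in> A. L1 y z \<or> L2 u z \<or> L3 u y}"
      "{u \<in> A. (x, u, z) \<in> C} = {u \<in> A. L1 u z \<or> L2 x z \<or> L3 x u}"
      "{u \<in> A. (x, y, u) \<in> C} = {u \<in> A. L1 y u \<or> L2 x u \<or> L3 x y}"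
      using iff xyz by auto
    show "(card {u \<in> A. L2 x u} + card {u \<in> A. L3 x u})
      + (card {u \<in> A. L1 y u} + card {u \<in> A. L3 u y})
      + (card {u \<in> A. L1 u z} + card {u \<in> A. L2 u z}) = g"
      using sums[OF xyz] line_sums_disjoint_lines[OF fin disj xyz]
      unfolding eq iff[OF xyz] of_bool_def by (simp split: if_splits)
  qed
qed

section \<open>Both directions of the classification, eigenvalue by eigenvalue\<close>

theorem theorem7:
  fixes A :: "'a set" and q :: nat and \<beta> \<gamma> :: int
  assumes "finite A" and "card A = q" and "q \<ge> 2"
    and "\<gamma> \<le> \<beta>"
  shows "(\<exists>C. completely_regular_code A C \<beta> \<gamma>) \<longleftrightarrow>
      (code_eigenvalue q \<beta> \<gamma> = hamming_eigenvalue q 1 \<and>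
         0 < \<gamma> \<and> 2 * \<gamma> \<le> int q)
    \<or> (code_eigenvalue q \<beta> \<gamma> = hamming_eigenvalue q 2 \<and>
         ((even \<gamma> \<and> 2 \<le> \<gamma> \<and> \<gamma> \<le> int q)
        \<or> (even q \<and> int q \<le> 2 * \<gamma> \<and> \<gamma> \<le> int q)
        \<or> (even q \<and> odd \<gamma> \<and> 2 * \<gamma> < int q \<and> condition1 q \<gamma>)))
    \<or> (code_eigenvalue q \<beta> \<gamma> = hamming_eigenvalue q 3 \<and>
         0 < \<gamma> \<and> 3 dvd \<gamma>)"
    (is "_ \<longleftrightarrow> ?case1 \<or> ?case2 \<or> ?case3")
proof
  assume "\<exists>C. completely_regular_code A C \<beta> \<gamma>"
  then obtain C where C: "completely_regular_code A C \<beta> \<gamma>" ..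
  note crc = C[unfolded completely_regular_code_iff_line_sums[OF assms(1)] assms(2)]
  have "\<gamma> \<ge> 1" using crc by blast
  define f :: "'a \<Rightarrow> 'a \<Rightarrow> 'a \<Rightarrow> int" where "f x y z = of_bool ((x, y, z) \<in> C)" for x y z
  have card: "(\<Sum>u\<in>A. of_bool (Q u)) = int (card {u \<in> A. Q u})" for Q
    using assms(1) by (simp add: of_bool_def sum.If_cases Int_def)
  have f: "(\<Sum>u\<in>A. f u y z) + (\<Sum>u\<in>A. f x u z) + (\<Sum>u\<in>A. f x y u)
      = \<gamma> + (3 * int q - (\<beta> + \<gamma>)) * f x y z" if "x \<in> A" "y \<in> A" "z \<in> A" for x y z
    using crc that by (simp add: f_def card)
  have "C \<noteq> {}" and sub: "C \<subset> hamming_vertices A" using crc by blast+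
  then obtain v w where "v \<in> C" "v \<in> hamming_vertices A" "w \<in> hamming_vertices A" "w \<notin> C"
    by blast
  then obtain x y z x' y' z' where pts: "x \<in> A" "y \<in> A" "z \<in> A" "x' \<in> A" "y' \<in> A" "z' \<in> A"
    "(x, y, z) \<in> C" "(x', y', z') \<notin> C"
    by (cases v, cases w) (auto simp: hamming_vertices_def)
  \<comment> \<open>The indicator function of \<open>C\<close> is not constant, and \<beta> +
    \<gamma> > 0 excludes \<theta> = 3q.\<close>
  have "3 * int q - (\<beta> + \<gamma>) = 2 * int q
    \<or> 3 * int q - (\<beta> + \<gamma>) = int q \<and> even (\<gamma> * int q)
    \<or> 3 * int q - (\<beta> + \<gamma>) = 0 \<and> 3 dvd \<gamma>"
    by (rule eigenfunction_cases[OF assms(1) _ f pts(1-6)])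
       (use pts \<open>\<gamma> \<ge> 1\<close> assms in \<open>auto simp: f_def\<close>)
  then consider "\<beta> + \<gamma> = int q" | "\<beta> + \<gamma> = 2 * int q" "even (\<gamma> * int q)"
    | "\<beta> + \<gamma> = 3 * int q" "3 dvd \<gamma>"
    by linarith
  then show "?case1 \<or> ?case2 \<or> ?case3"
  proof cases
    case 1
    then show ?thesis using assms(4) \<open>\<gamma> \<ge> 1\<close> by (simp add: code_eigenvalue_eq_iff)
  next
    case 2
    then have "\<beta> = 2 * int (card A) - int (nat \<gamma>)" "\<gamma> = int (nat \<gamma>)"
      using assms(2) \<open>\<gamma> \<ge> 1\<close> by auto
    then have "condition1 q \<gamma>" if "odd \<gamma>" "2 * \<gamma> < int q"
      using condition1_necessary[of A C "nat \<gamma>"] C assms(1,2) that \<open>\<gamma> \<ge> 1\<close>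
      by (auto simp: even_nat_iff)
    moreover have "2 \<le> \<gamma>" if "even \<gamma>"
      using that \<open>\<gamma> \<ge> 1\<close> by (cases "\<gamma> = 1") auto
    moreover have "even q" if "odd \<gamma>" using that 2(2) by simp
    moreover have "\<gamma> \<le> int q" using 2(1) assms(4) by simp
    moreover have "code_eigenvalue q \<beta> \<gamma> = hamming_eigenvalue q 2"
      using 2(1) by (simp add: code_eigenvalue_eq_iff)
    ultimately have ?case2 by (meson not_le)
    then show ?thesis by blast
  next
    case 3
    then show ?thesis using \<open>\<gamma> \<ge> 1\<close> by (simp add: code_eigenvalue_eq_iff)
  qed
next
  assume R: "?case1 \<or> ?case2 \<or> ?case3"
  have ne: "A \<noteq> {}" using assms(2,3) by auto
  have even: "\<exists>C. completely_regular_code A C \<beta> \<gamma>"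
    if "\<beta> + \<gamma> = 2 * int q" "even \<gamma>" "\<gamma> \<ge> 1"
  proof -
    define k where "k = nat (\<gamma> div 2)"
    have \<gamma>: "\<gamma> = 2 * int k" using that(2,3) by (auto simp: k_def elim: evenE)
    have \<beta>: "\<beta> = 2 * int (card A) - 2 * int k" using \<gamma> that(1) assms(2) by simp
    have "k \<ge> 1" "k < card A" using \<gamma> \<beta> that(3) assms(2-4) by auto
    then show ?thesis unfolding \<gamma> \<beta> by (rule code_eigenvalue2_even_exists[OF assms(1) ne])
  qed
  \<comment> \<open>For eigenvalue \<lambda>_2 every even \<gamma> is served by parallel lines, also
    in the range from q/2 to q, where \<open>q \<ge> 2\<close> gives \<gamma> \<ge> 1. The
    construction with two boxes is thus called only for odd \<gamma>.\<close>
  from R consider "\<beta> + \<gamma> = int q" "0 < \<gamma>"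
    | "\<beta> + \<gamma> = 2 * int q" "even \<gamma>" "\<gamma> \<ge> 1"
    | "\<beta> + \<gamma> = 2 * int q" "odd \<gamma>" "even q" "int q \<le> 2 * \<gamma>" "\<gamma> \<le> int q"
    | "\<beta> + \<gamma> = 2 * int q" "2 * \<gamma> < int q" "condition1 q \<gamma>"
    | "\<beta> + \<gamma> = 3 * int q" "0 < \<gamma>" "3 dvd \<gamma>"
    using assms(3) by (cases "even \<gamma>") (auto simp: code_eigenvalue_eq_iff)
  then show "\<exists>C. completely_regular_code A C \<beta> \<gamma>"
  proof cases
    case 1
    have \<gamma>: "\<gamma> = int (nat \<gamma>)" using 1 by simp
    have \<beta>: "\<beta> = int (card A) - int (nat \<gamma>)" using 1 assms(2) by simp
    have "nat \<gamma> \<ge> 1" "nat \<gamma> < card A" using 1 assms(2,4) by auto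
    from code_eigenvalue1_exists[OF assms(1) this] show ?thesis
      unfolding \<beta>[symmetric] unfolding \<gamma>[symmetric] .
  next
    case 2
    then show ?thesis by (rule even)
  next
    case 3
    have \<gamma>: "\<gamma> = int (nat \<gamma>)" using 3 by simp
    have \<beta>: "\<beta> = 2 * int (card A) - int (nat \<gamma>)" using 3 assms(2) by simp
    have "card A = 2 * (q div 2)" "odd (nat \<gamma>)" "q div 2 \<le> nat \<gamma>" "nat \<gamma> \<le> 2 * (q div 2)"
      using 3 assms(2) by (auto simp: even_nat_iff)
    from code_eigenvalue2_half_exists[OF assms(1) this] show ?thesis
      unfolding \<beta>[symmetric] unfolding \<gamma>[symmetric] .
  next
    case 4
    have \<beta>: "\<beta> = 2 * int (card A) - \<gamma>" using 4 assms(2) by simp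
    have "condition1 (card A) \<gamma>" "\<gamma> < 2 * int (card A)" using 4 assms(2) by auto
    then show ?thesis
      unfolding \<beta> by (rule code_eigenvalue2_condition1_exists[OF assms(1)])
  next
    case 5
    define k where "k = nat (\<gamma> div 3)"
    have \<gamma>: "\<gamma> = 3 * int k" using 5 by (auto simp: k_def elim: dvdE)
    have \<beta>: "\<beta> = 3 * int (card A) - 3 * int k" using \<gamma> 5 assms(2) by simp
    have "k \<ge> 1" "k < card A" using \<gamma> \<beta> 5 assms(2-4) by auto
    then show ?thesis unfolding \<gamma> \<beta> by (rule code_eigenvalue3_exists[OF assms(1)])
  qed
qed

end
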